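(* Let $g\colon U\to V$ be a morphism of Lie algebras over a field of characteristic $0$ and $T=U\oplus V$. Let $k\ge3$, let $\theta_s\in C^{n_s}_{\mathbf{Lie}_{B\to W}}(T;T)$ for $1\le s\le k$, correspond to $(\theta_{s,U},\theta_{s,V},\theta_{s,g})\in\Lambda^{n_s+1}(U,V)$, and put $t=-k+2+\sum_{s=1}^kn_s$, so that $l_k(\theta_1,\ldots,\theta_k)\in C^t_{\mathbf{Lie}_{B\to W}}(T;T)$. Then $$l_k(\theta_1,\ldots,\theta_k)(\mu_{t+1})=0,\qquad l_k(\theta_1,\ldots,\theta_k)(\nu_{t+1})=0,$$ and $$l_k(\theta_1,\ldots,\theta_k)(f_t)=(-1)^{\nu(\theta_1,\ldots,\theta_k)}\sum_{s=1}^k\sum_{\mathbf a'\in A}\ \sum_{\sigma\in S^<_{r_1,\ldots,r_{n_s+1}}}\mathrm{sgn}(\sigma)\,(-1)^{\mathbf a'}\,\theta_{s,V}\circ_{\mathbf a'}(\theta_{1,g},\ldots,\widehat{\theta_{s,g}},\ldots,\theta_{k,g})\circ\sigma .$$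
   Context: $\mathbf k$ is a field of characteristic $0$; $(U,\mu_U)$, $(V,\mu_V)$ are Lie algebras over $\mathbf k$ with brackets $\mu_U,\mu_V$, and $g\colon U\to V$ is a Lie algebra morphism. $T=U\oplus V$ is two-colored with $T_B=U$, $T_W=V$; $\mathrm{End}_T$ is its 2-colored endomorphism PROP (multilinear maps between tensor products of $U$'s and $V$'s). **Permutations.** $S_{p,q}$ is the set of $(p,q)$-unshuffles: $\sigma(1)<\cdots<\sigma(p)$ and $\sigma(p+1)<\cdots<\sigma(p+q)$. For $r_1\le\cdots\le r_l$, $S^<_{r_1,\ldots,r_l}$ is the set of $(r_1,\ldots,r_l)$-unshuffles with $\sigma(r_1+\cdots+r_{i-1}+1)<\sigma(r_1+\cdots+r_i+1)$ whenever $r_i=r_{i+1}$. $(F\circ\sigma)(x_1,\ldots,x_N)=F(x_{\sigma(1)},\ldots,x_{\sigma(N)})$. **Minimal model.** $\mathbf{Lie}_{B\to W}$ is the 2-colored operad whose algebras are morphisms of Lie algebras. Its minimal model is $(\mathsf F(E),\partial)$, the free 2-colored PROP on the 2-colored $\Sigma$-bimodule $E$ with skew-symmetric generators $\mu_n\colon B^{\otimes n}\to B$ of degree $n-2$ ($n\ge2$), $\nu_n\colon W^{\otimes n}\to W$ of degree $n-2$ ($n\ge2$), $f_n\colon B^{\otimes n}\to W$ of degree $n-1$ ($n\ge1$), and $$\partial(\mu_n)=\sum_{\substack{i+j=n+1\\ i,j\ge2}}(-1)^{j(i-1)}\sum_{\sigma\in S_{j,i-1}}\mathrm{sgn}(\sigma)\,\mu_i\circ(\mu_j\otimes\mathrm{Id}^{\otimes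 i-1})\circ\sigma,$$ $\partial(\nu_n)$ is given by the same formula with $\nu$ in place of $\mu$, and $$\begin{aligned}\partial(f_n)={}&\sum_{l=2}^n\sum_{\substack{r_1+\cdots+r_l=n\\ r_1\le\cdots\le r_l}}(-1)^{\frac{l(l-1)}2+\sum_{i=1}^{l-1}r_i(l-i)}\sum_{\sigma\in S^<_{r_1,\ldots,r_l}}\mathrm{sgn}(\sigma)\,\nu_l(f_{r_1}\otimes\cdots\otimes f_{r_l})\circ\sigma\\&-\sum_{\substack{i+j=n+1\\ i\ge1,j\ge2}}(-1)^{j(i-1)}\sum_{\sigma\in S_{j,i-1}}\mathrm{sgn}(\sigma)\,f_i\circ(\mu_j\otimes\mathrm{Id}^{\otimes i-1})\circ\sigma.\end{aligned}$$ The morphism $g$ corresponds to $\beta\colon\mathsf F(E)\to\mathrm{End}_T$ with $\beta(\mu_2)=\mu_U$, $\beta(\nu_2)=\mu_V$, $\beta(f_1)=g$, and $\beta=0$ on all other generators. **Deformation complex.** $C^*_{\mathbf{Lie}_{B\to W}}(T;T)\cong\,\uparrow\mathrm{Hom}_\Sigma(E,\mathrm{End}_T)^{-*}$ ($\uparrow$ suspension, $-*$ reversed grading): $\theta\in C^p$ ($p\ge1$), of degree $|\theta|=p$, is a color-preserving equivariant linear map $E\to\mathrm{End}_T$ supported on generators of degree $p-1$, identified with $(\theta_U,\theta_V,\theta_g):=(\theta(\mu_{p+1}),\theta(\nu_{p+1}),\theta(f_p))\in\Lambda^{p+1}(U,V)$, where $\Lambda^n(U,V)=\mathrm{Hom}(U^{\wedge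 n},U)\oplus\mathrm{Hom}(V^{\wedge n},V)\oplus\mathrm{Hom}(U^{\wedge n-1},V)$. In the claim all $n_s\ge1$. **Operations $l_k$.** For cochains $F_1,\ldots,F_k$ and a generator $\xi$, write $\partial(\xi)=\sum_s\Gamma_s$ as a sum of $E$-decorated graphs (as displayed). Then $$l_k(F_1,\ldots,F_k)(\xi)=(-1)^{\nu(F_1,\ldots,F_k)}\sum_s\sum_{(v_1,\ldots,v_k)}\gamma\big(\Gamma_s^{\{v_1,\ldots,v_k\}}[F_1,\ldots,F_k]\big),\qquad \nu(F_1,\ldots,F_k)=(k-1)|F_1|+(k-2)|F_2|+\cdots+|F_{k-1}|,$$ where $(v_1,\ldots,v_k)$ runs over all $k$-tuples of distinct vertices of $\Gamma_s$, the graph $\Gamma_s^{\{v_1,\ldots,v_k\}}[F_1,\ldots,F_k]$ is obtained by replacing the decoration $e_{v_i}$ of $v_i$ by $F_i(e_{v_i})$ and every other decoration $e_v$ by $\beta(e_v)$, and $\gamma$ is the resulting composite in $\mathrm{End}_T$. The only signs are the displayed ones and the coefficients in $\partial(\xi)$. **Generalized comp operation.** A hat denotes omission. For fixed $s$, let $\mathbf a'=(a_1,\ldots,\widehat{a_s},\ldots,a_k)$ be a $(k-1)$-tuple of distinct points of $\{1,\ldots,n_s+1\}$. Then $\theta_{s,V}\circ_{\mathbf a'}(\theta_{1,g},\ldots,\widehat{\theta_{s,g}},\ldots,\theta_{k,g})\in\mathrm{Hom}(U^{\otimes t},V)$ is obtained by plugging $\theta_{j,g}$ ($j\ne s$) into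 the $a_j$-th input of $\theta_{s,V}$ and $g$ into the other $n_s+2-k$ inputs. For $a\in\{1,\ldots,n_s+1\}$ put $r_a=|\theta_j|=n_j$ if $a=a_j$ for some $j\ne s$, and $r_a=1$ otherwise (so $r_1+\cdots+r_{n_s+1}=t$). The sign is $$(-1)^{\mathbf a'}=(-1)^{\frac{(n_s+1)n_s}2+\sum_{i=1}^{n_s+1}r_i(n_s+1-i)}.$$ $\mathbf a'$ is admissible if $r_1\le\cdots\le r_{n_s+1}$; $A$ denotes the set of admissible $\mathbf a'$ (for the given $s$).
   Formalization: "So that l_k(θ_1,…,θ_k) ∈ C^t" is proved only as multilinear, color-preserving and of degree t; equivariance (skew symmetry) is not claimed, since with only the displayed signs it fails, e.g. for k=3, n=(1,2,2), θ_1=(0,b,0), θ_2=θ_3=(0,0,f). *)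

theory Defs
  imports
    Complex_Main
    "HOL-Library.Poly_Mapping"
    "HOL-Library.FuncSet"
    "HOL-Combinatorics.Permutations"
begin

section \<open>Lie algebras and their morphisms\<close>

locale lie_algebra = vector_space scale
  for scale :: "'k::field \<Rightarrow> 'a::ab_group_add \<Rightarrow> 'a" +
  fixes bracket :: "'a \<Rightarrow> 'a \<Rightarrow> 'a"
  assumes linear_right: "Vector_Spaces.linear scale scale (\<lambda>y. bracket x y)"
    and linear_left: "Vector_Spaces.linear scale scale (\<lambda>x. bracket x y)"
    and alternating: "bracket x x = 0"
    and jacobi: "bracket x (bracket y z) + bracket y (bracket z x) + bracket z (bracket x y) = 0"

definition lie_morphism ::
  "('k::field \<Rightarrow> 'u::ab_group_add \<Rightarrow> 'u) \<Rightarrow> ('u \<Rightarrow> 'u \<Rightarrow> 'u) \<Rightarrow>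
   ('k \<Rightarrow> 'v::ab_group_add \<Rightarrow> 'v) \<Rightarrow> ('v \<Rightarrow> 'v \<Rightarrow> 'v) \<Rightarrow> ('u \<Rightarrow> 'v) \<Rightarrow> bool" where
  "lie_morphism sU muU sV muV g \<longleftrightarrow>
     Vector_Spaces.linear sU sV g \<and> (\<forall>x y. g (muU x y) = muV (g x) (g y))"


section \<open>Multilinear maps\<close>

text \<open>An \<open>n\<close>-ary map is a function on argument lists of which only the values on lists of length
  \<open>n\<close> are meaningful. Permutations act on the positions \<open>1, \<dots>, N\<close>, whereas list positions
  count from \<open>0\<close>.\<close>

definition perm_args :: "(nat \<Rightarrow> nat) \<Rightarrow> 'a list \<Rightarrow> 'a list" where
  "perm_args \<sigma> xs = map (\<lambda>i. xs ! (\<sigma> i - 1)) [1..<length xs + 1]"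

definition multilinear ::
  "('k::field \<Rightarrow> 'a::ab_group_add \<Rightarrow> 'a) \<Rightarrow> ('k \<Rightarrow> 'b::ab_group_add \<Rightarrow> 'b) \<Rightarrow>
   nat \<Rightarrow> ('a list \<Rightarrow> 'b) \<Rightarrow> bool" where
  "multilinear sA sB n \<phi> \<longleftrightarrow>
     (\<forall>xs i. length xs = n \<longrightarrow> i < n \<longrightarrow> Vector_Spaces.linear sA sB (\<lambda>x. \<phi> (xs[i := x])))"

definition skew_symmetric ::
  "('k::field \<Rightarrow> 'b::ab_group_add \<Rightarrow> 'b) \<Rightarrow> nat \<Rightarrow> ('a list \<Rightarrow> 'b) \<Rightarrow> bool" where
  "skew_symmetric sB n \<phi> \<longleftrightarrow>
     (\<forall>xs \<sigma>. length xs = n \<longrightarrow> \<sigma> permutes {1..n} \<longrightarrow>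
        \<phi> (perm_args \<sigma> xs) = sB (of_int (sign \<sigma>)) (\<phi> xs))"

definition vanishes :: "nat \<Rightarrow> ('a list \<Rightarrow> 'b::zero) \<Rightarrow> bool" where
  "vanishes n \<phi> \<longleftrightarrow> (\<forall>xs. length xs = n \<longrightarrow> \<phi> xs = 0)"


section \<open>Unshuffles\<close>

definition psum :: "nat list \<Rightarrow> nat \<Rightarrow> nat" where
  "psum r i = sum_list (take i r)"

definition unshuffles :: "nat list \<Rightarrow> (nat \<Rightarrow> nat) set" where
  "unshuffles r = {\<sigma>. \<sigma> permutes {1..sum_list r} \<and>
     (\<forall>i<length r. strict_mono_on {psum r i + 1..psum r (i + 1)} \<sigma>)}"

definition unshuffles_less :: "nat list \<Rightarrow> (nat \<Rightarrow> nat) set" where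
  "unshuffles_less r = {\<sigma> \<in> unshuffles r.
     \<forall>i. i + 1 < length r \<longrightarrow> r ! i = r ! (i + 1) \<longrightarrow>
       \<sigma> (psum r i + 1) < \<sigma> (psum r (i + 1) + 1)}"


section \<open>Decorated graphs and the differential of the minimal model\<close>

text \<open>The generators \<open>\<mu>\<^sub>n, \<nu>\<^sub>n\<close> exist for \<open>n \<ge> 2\<close> and \<open>f\<^sub>n\<close> for \<open>n \<ge> 1\<close>; the remaining terms
  of the type \<open>gen\<close> are not generators.\<close>

datatype gen = Mu nat | Nu nat | Fn nat

fun is_gen :: "gen \<Rightarrow> bool" where
  "is_gen (Mu n) \<longleftrightarrow> 2 \<le> n"
| "is_gen (Nu n) \<longleftrightarrow> 2 \<le> n"
| "is_gen (Fn n) \<longleftrightarrow> 1 \<le> n"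

fun gen_degree :: "gen \<Rightarrow> int" where
  "gen_degree (Mu n) = int n - 2"
| "gen_degree (Nu n) = int n - 2"
| "gen_degree (Fn n) = int n - 1"

text \<open>The differential only involves the operadic part of the free PROP, so all graphs are rooted
  planar trees with labelled legs. The parameter \<open>'e\<close> is the set of decorations; renaming
  the legs along \<open>\<sigma>\<close> is the right action \<open>\<Gamma> \<circ> \<sigma>\<close>: input \<open>m\<close> of \<open>\<Gamma>\<close> receives \<open>x\<close> with index \<open>\<sigma> m\<close>.\<close>

datatype ('e, 'x) graph = Leg 'x | Vertex 'e "('e, 'x) graph list"

definition act :: "('e, nat) graph \<Rightarrow> (nat \<Rightarrow> nat) \<Rightarrow> ('e, nat) graph" where
  "act \<Gamma> \<sigma> = map_graph id \<sigma> \<Gamma>"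

text \<open>A corolla with inputs \<open>m + 1, \<dots>, m + n\<close>.\<close>

definition corolla :: "'e \<Rightarrow> nat \<Rightarrow> nat \<Rightarrow> ('e, nat) graph" where
  "corolla e m n = Vertex e (map Leg [m + 1..<m + n + 1])"

text \<open>\<open>a \<circ> (b \<otimes> Id\<^sup>i\<^sup>-\<^sup>1)\<close> for \<open>a\<close> of arity \<open>i\<close> and \<open>b\<close> of arity \<open>j\<close>.\<close>

definition graft_first :: "'e \<Rightarrow> nat \<Rightarrow> 'e \<Rightarrow> nat \<Rightarrow> ('e, nat) graph" where
  "graft_first a i b j = Vertex a (corolla b 0 j # map Leg [j + 1..<j + i])"

text \<open>\<open>\<nu>\<^sub>l (f\<^sub>r\<^sub>1 \<otimes> \<dots> \<otimes> f\<^sub>r\<^sub>l)\<close>\<close>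

definition graft_all :: "nat list \<Rightarrow> (gen, nat) graph" where
  "graft_all r = Vertex (Nu (length r))
     (map (\<lambda>i. corolla (Fn (r ! i)) (psum r i) (r ! i)) [0..<length r])"

definition lie_part ::
  "(nat \<Rightarrow> gen) \<Rightarrow> (nat \<Rightarrow> gen) \<Rightarrow> nat \<Rightarrow> nat \<Rightarrow> (gen, nat) graph \<Rightarrow>\<^sub>0 'k::field" where
  "lie_part a b i0 n =
     (\<Sum>(i, j) \<in> {(i, j). i + j = n + 1 \<and> i0 \<le> i \<and> 2 \<le> j}. \<Sum>\<sigma> \<in> unshuffles [j, i - 1].
        Poly_Mapping.single (act (graft_first (a i) i (b j) j) \<sigma>)
          ((-1) ^ (j * (i - 1)) * of_int (sign \<sigma>)))"

text \<open>The sequences \<open>r\<^sub>1 \<le> \<dots> \<le> r\<^sub>l\<close> of positive integers with sum \<open>n\<close>.\<close>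

definition compositions :: "nat \<Rightarrow> nat \<Rightarrow> nat list set" where
  "compositions l n = {r. length r = l \<and> (\<forall>x\<in>set r. 1 \<le> x) \<and> sum_list r = n \<and> sorted r}"

text \<open>With \<open>r\<^sub>i\<close> being \<open>r ! (i - 1)\<close>, this is the exponent of both the sign in
  \<open>\<partial>(f\<^sub>n)\<close> and the sign of the generalized comp operation. There the sum stops at \<open>l - 1\<close>
  in the former case, but the summand for \<open>i = l\<close> is zero.\<close>

definition block_exponent :: "nat list \<Rightarrow> nat" where
  "block_exponent r = (let l = length r in
     l * (l - 1) div 2 + (\<Sum>i=1..l. r ! (i - 1) * (l - i)))"

text \<open>\<open>\<partial>\<close> on generators, as the displayed formal linear combination of graphs. Graphs are
  not identified along the skew symmetry of the generators, since the operations \<open>l\<^sub>k\<close> are defined by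
  the displayed representatives.\<close>

fun bd :: "gen \<Rightarrow> (gen, nat) graph \<Rightarrow>\<^sub>0 'k::field" where
  "bd (Mu n) = lie_part Mu Mu 2 n"
| "bd (Nu n) = lie_part Nu Nu 2 n"
| "bd (Fn n) =
     (\<Sum>l=2..n. \<Sum>r\<in>compositions l n. \<Sum>\<sigma>\<in>unshuffles_less r.
        Poly_Mapping.single (act (graft_all r) \<sigma>)
          ((-1) ^ block_exponent r * of_int (sign \<sigma>)))
     - lie_part Fn Mu 1 n"


section \<open>Maps from the generators to the endomorphism PROP\<close>

text \<open>The color-preserving maps \<open>E \<rightarrow> End\<^sub>T\<close>, \<open>T\<^sub>B = U\<close>, \<open>T\<^sub>W = V\<close>, given by their values on generators.\<close>

record ('u, 'v) emap =
  at_mu :: "nat \<Rightarrow> 'u list \<Rightarrow> 'u"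
  at_nu :: "nat \<Rightarrow> 'v list \<Rightarrow> 'v"
  at_f :: "nat \<Rightarrow> 'u list \<Rightarrow> 'v"

text \<open>The parts of \<open>End\<^sub>T\<close> in which such maps take values.\<close>

datatype ('u, 'v) endo = BB "'u list \<Rightarrow> 'u" | WW "'v list \<Rightarrow> 'v" | BW "'u list \<Rightarrow> 'v"

fun emap_app :: "('u, 'v) emap \<Rightarrow> gen \<Rightarrow> ('u, 'v) endo" where
  "emap_app \<theta> (Mu n) = BB (at_mu \<theta> n)"
| "emap_app \<theta> (Nu n) = WW (at_nu \<theta> n)"
| "emap_app \<theta> (Fn n) = BW (at_f \<theta> n)"

text \<open>The values lie in \<open>End\<^sub>T\<close>, and the map is supported on the generators of degree \<open>p - 1\<close>.\<close>

definition homogeneous ::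
  "('k::field \<Rightarrow> 'u::ab_group_add \<Rightarrow> 'u) \<Rightarrow> ('k \<Rightarrow> 'v::ab_group_add \<Rightarrow> 'v) \<Rightarrow>
   nat \<Rightarrow> ('u, 'v) emap \<Rightarrow> bool" where
  "homogeneous sU sV p \<theta> \<longleftrightarrow>
     (\<forall>n. is_gen (Mu n) \<longrightarrow> multilinear sU sU n (at_mu \<theta> n) \<and>
        (gen_degree (Mu n) \<noteq> int p - 1 \<longrightarrow> vanishes n (at_mu \<theta> n))) \<and>
     (\<forall>n. is_gen (Nu n) \<longrightarrow> multilinear sV sV n (at_nu \<theta> n) \<and>
        (gen_degree (Nu n) \<noteq> int p - 1 \<longrightarrow> vanishes n (at_nu \<theta> n))) \<and>
     (\<forall>n. is_gen (Fn n) \<longrightarrow> multilinear sU sV n (at_f \<theta> n) \<and>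
        (gen_degree (Fn n) \<noteq> int p - 1 \<longrightarrow> vanishes n (at_f \<theta> n)))"

text \<open>The generators are skew-symmetric, hence so are the values of an equivariant map.\<close>

definition equivariant ::
  "('k::field \<Rightarrow> 'u::ab_group_add \<Rightarrow> 'u) \<Rightarrow> ('k \<Rightarrow> 'v::ab_group_add \<Rightarrow> 'v) \<Rightarrow>
   ('u, 'v) emap \<Rightarrow> bool" where
  "equivariant sU sV \<theta> \<longleftrightarrow>
     (\<forall>n. is_gen (Mu n) \<longrightarrow> skew_symmetric sU n (at_mu \<theta> n)) \<and>
     (\<forall>n. is_gen (Nu n) \<longrightarrow> skew_symmetric sV n (at_nu \<theta> n)) \<and>
     (\<forall>n. is_gen (Fn n) \<longrightarrow> skew_symmetric sV n (at_f \<theta> n))"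

text \<open>The cochains of degree \<open>p \<ge> 1\<close>. The triple \<open>(\<theta>\<^sub>U, \<theta>\<^sub>V, \<theta>\<^sub>g)\<close> corresponding to \<open>\<theta>\<close> is
  \<open>(at_mu \<theta> (p + 1), at_nu \<theta> (p + 1), at_f \<theta> p)\<close>.\<close>

definition cochain ::
  "('k::field \<Rightarrow> 'u::ab_group_add \<Rightarrow> 'u) \<Rightarrow> ('k \<Rightarrow> 'v::ab_group_add \<Rightarrow> 'v) \<Rightarrow>
   nat \<Rightarrow> ('u, 'v) emap \<Rightarrow> bool" where
  "cochain sU sV p \<theta> \<longleftrightarrow> homogeneous sU sV p \<theta> \<and> equivariant sU sV \<theta>"

definition beta ::
  "('u::zero \<Rightarrow> 'u \<Rightarrow> 'u) \<Rightarrow> ('v::zero \<Rightarrow> 'v \<Rightarrow> 'v) \<Rightarrow> ('u \<Rightarrow> 'v) \<Rightarrow> ('u, 'v) emap" where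
  "beta muU muV g = \<lparr>
     at_mu = (\<lambda>n xs. if n = 2 then muU (xs ! 0) (xs ! 1) else 0),
     at_nu = (\<lambda>n ys. if n = 2 then muV (ys ! 0) (ys ! 1) else 0),
     at_f = (\<lambda>n xs. if n = 1 then g (xs ! 0) else 0)\<rparr>"


section \<open>The operations \<open>l\<^sub>k\<close>\<close>

text \<open>A vertex is addressed by the path from the root to it.\<close>

lemma size_nth_graph [termination_simp]:
  "i < length ts \<Longrightarrow> size (ts ! i) < Suc (size_list size ts)"
  using size_list_estimation'[OF nth_mem order_refl, of i ts size] by simp

fun vertices :: "('e, 'x) graph \<Rightarrow> nat list set" where
  "vertices (Leg x) = {}"
| "vertices (Vertex e ts) =
     insert [] (\<Union>i\<in>{0..<length ts}. (\<lambda>p. i # p) ` vertices (ts ! i))"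

text \<open>Replaces the decoration \<open>e\<close> of each vertex \<open>p\<close> by \<open>h p e\<close>.\<close>

fun redecorate :: "(nat list \<Rightarrow> 'e \<Rightarrow> 'd) \<Rightarrow> ('e, 'x) graph \<Rightarrow> ('d, 'x) graph" where
  "redecorate h (Leg x) = Leg x"
| "redecorate h (Vertex e ts) = Vertex (h [] e)
     (map (\<lambda>i. redecorate (\<lambda>p. h (i # p)) (ts ! i)) [0..<length ts])"

text \<open>The graph obtained by inserting \<open>F i\<close> at the vertex \<open>v i\<close> for \<open>1 \<le> i \<le> k\<close>, and \<open>\<beta>\<close> elsewhere.\<close>

definition insert_at ::
  "('u, 'v) emap \<Rightarrow> nat \<Rightarrow> (nat \<Rightarrow> ('u, 'v) emap) \<Rightarrow> (nat \<Rightarrow> nat list) \<Rightarrow>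
   (gen, 'x) graph \<Rightarrow> (('u, 'v) endo, 'x) graph" where
  "insert_at \<beta> k F v \<Gamma> = redecorate (\<lambda>p.
     if p \<in> v ` {1..k} then emap_app (F (inv_into {1..k} v p)) else emap_app \<beta>) \<Gamma>"

text \<open>The composite \<open>\<gamma>\<close> of a graph decorated by elements of \<open>End\<^sub>T\<close>, evaluated on inputs: \<open>gamma_B\<close>
  for output color \<open>B\<close> and \<open>gamma_W\<close> for output color \<open>W\<close>. The latter takes the values of the legs
  of either color; the value \<open>0\<close> of ill-colored graphs is irrelevant.\<close>

fun gamma_B :: "(nat \<Rightarrow> 'u) \<Rightarrow> (('u::zero, 'v) endo, nat) graph \<Rightarrow> 'u" where
  "gamma_B x (Leg i) = x i"
| "gamma_B x (Vertex \<phi> ts) =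
     (case \<phi> of BB h \<Rightarrow> h (map (gamma_B x) ts) | _ \<Rightarrow> 0)"

fun gamma_W :: "(nat \<Rightarrow> 'u) \<Rightarrow> (nat \<Rightarrow> 'v) \<Rightarrow> (('u::zero, 'v::zero) endo, nat) graph \<Rightarrow> 'v" where
  "gamma_W x y (Leg i) = y i"
| "gamma_W x y (Vertex \<phi> ts) =
     (case \<phi> of BB h \<Rightarrow> 0 | WW h \<Rightarrow> h (map (gamma_W x y) ts) | BW h \<Rightarrow> h (map (gamma_B x) ts))"

definition inputs :: "'a list \<Rightarrow> nat \<Rightarrow> 'a" where
  "inputs xs i = xs ! (i - 1)"

text \<open>The exponent \<open>\<nu>(F\<^sub>1, \<dots>, F\<^sub>k)\<close> for \<open>F\<^sub>i\<close> of degree \<open>n i\<close>.\<close>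

definition nu_exponent :: "nat \<Rightarrow> (nat \<Rightarrow> nat) \<Rightarrow> nat" where
  "nu_exponent k n = (\<Sum>i=1..k. (k - i) * n i)"

text \<open>The value of \<open>l\<^sub>k(F\<^sub>1, \<dots>, F\<^sub>k)\<close> on the generator \<open>\<xi>\<close>, at inputs fixed by the evaluation \<open>ev\<close> of
  \<open>End\<^sub>T\<close>-decorated graphs, whose values lie in a vector space with scalar multiplication \<open>sc\<close>.
  A tuple of distinct vertices is an injective function on \<open>{1..k}\<close>.\<close>

definition l_value ::
  "('k::field \<Rightarrow> 'c::ab_group_add \<Rightarrow> 'c) \<Rightarrow> ((('u, 'v) endo, nat) graph \<Rightarrow> 'c) \<Rightarrow>
   ('u, 'v) emap \<Rightarrow> nat \<Rightarrow> (nat \<Rightarrow> nat) \<Rightarrow> (nat \<Rightarrow> ('u, 'v) emap) \<Rightarrow> gen \<Rightarrow> 'c" where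
  "l_value sc ev \<beta> k n F \<xi> = sc ((-1) ^ nu_exponent k n)
     (\<Sum>\<Gamma>\<in>Poly_Mapping.keys (bd \<xi> :: (gen, nat) graph \<Rightarrow>\<^sub>0 'k).
        sc (Poly_Mapping.lookup (bd \<xi>) \<Gamma>)
          (\<Sum>v\<in>{v \<in> {1..k} \<rightarrow>\<^sub>E vertices \<Gamma>. inj_on v {1..k}}. ev (insert_at \<beta> k F v \<Gamma>)))"

definition l_op ::
  "('k::field \<Rightarrow> 'u::ab_group_add \<Rightarrow> 'u) \<Rightarrow> ('k \<Rightarrow> 'v::ab_group_add \<Rightarrow> 'v) \<Rightarrow>
   ('u, 'v) emap \<Rightarrow> nat \<Rightarrow> (nat \<Rightarrow> nat) \<Rightarrow> (nat \<Rightarrow> ('u, 'v) emap) \<Rightarrow> ('u, 'v) emap" where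
  "l_op sU sV \<beta> k n F = \<lparr>
     at_mu = (\<lambda>m xs. l_value sU (gamma_B (inputs xs)) \<beta> k n F (Mu m)),
     at_nu = (\<lambda>m ys. l_value sV (gamma_W (\<lambda>_. 0) (inputs ys)) \<beta> k n F (Nu m)),
     at_f = (\<lambda>m xs. l_value sV (gamma_W (inputs xs) (\<lambda>_. 0)) \<beta> k n F (Fn m))\<rparr>"


section \<open>The generalized comp operation\<close>

text \<open>A tuple of points \<open>a\<^sub>j\<close>, \<open>j \<in> {1, \<dots>, k}\<close>, \<open>j \<noteq> s\<close>, is a function \<open>a\<close> on \<open>{1..k} - {s}\<close>.\<close>

definition block_sizes :: "nat \<Rightarrow> (nat \<Rightarrow> nat) \<Rightarrow> nat \<Rightarrow> (nat \<Rightarrow> nat) \<Rightarrow> nat list" where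
  "block_sizes k n s a = map (\<lambda>i.
     if i \<in> a ` ({1..k} - {s}) then n (inv_into ({1..k} - {s}) a i) else 1) [1..<n s + 2]"

definition admissible :: "nat \<Rightarrow> (nat \<Rightarrow> nat) \<Rightarrow> nat \<Rightarrow> (nat \<Rightarrow> nat) set" where
  "admissible k n s = {a \<in> ({1..k} - {s}) \<rightarrow>\<^sub>E {1..n s + 1}.
     inj_on a ({1..k} - {s}) \<and> sorted (block_sizes k n s a)}"

definition gen_comp ::
  "('u \<Rightarrow> 'v) \<Rightarrow> nat \<Rightarrow> (nat \<Rightarrow> nat) \<Rightarrow> (nat \<Rightarrow> ('u, 'v) emap) \<Rightarrow> nat \<Rightarrow> (nat \<Rightarrow> nat) \<Rightarrow>
   'u list \<Rightarrow> 'v" where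
  "gen_comp g k n \<theta> s a xs = at_nu (\<theta> s) (n s + 1)
     (map (\<lambda>i. let r = block_sizes k n s a;
                   blk = take (r ! (i - 1)) (drop (psum r (i - 1)) xs)
               in if i \<in> a ` ({1..k} - {s})
                  then let j = inv_into ({1..k} - {s}) a i in at_f (\<theta> j) (n j) blk
                  else g (hd blk))
          [1..<n s + 2])"

end

theory Submission
  imports Defs
begin

text \<open>The graphs \<open>\<mu>\<^sub>i \<circ> (\<mu>\<^sub>j \<otimes> Id)\<close>, \<open>\<nu>\<^sub>i \<circ> (\<nu>\<^sub>j \<otimes> Id)\<close>
  and \<open>f\<^sub>i \<circ> (\<mu>\<^sub>j \<otimes> Id)\<close> have two vertices, so for \<open>k \<ge> 3\<close> only the graphs
  \<open>\<nu>\<^sub>l (f\<^sub>r\<^sub>1 \<otimes> \<dots> \<otimes> f\<^sub>r\<^sub>l)\<close> contribute to \<open>l\<^sub>k\<close>. There the root must carry some cochain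
  \<open>\<theta>\<^sub>s\<close>: otherwise it carries \<open>\<beta>\<close>, which forces \<open>l = 2\<close> and leaves only two vertices. The other
  cochains then sit on the children \<open>a\<^sub>j\<close>, and since cochains and \<open>\<beta>\<close> (which has degree 1) are
  supported in a single degree, a nonzero term has \<open>l = n\<^sub>s + 1\<close> and block sizes determined by \<open>a\<close>.
  As \<open>r\<close> is sorted, the surviving \<open>a\<close> are the admissible ones.\<close>

section \<open>Linear extension from graphs to formal linear combinations\<close>

text \<open>In \<open>l_value\<close> the coefficients are read off after equal graphs have been
  merged. The resulting sum is linear in the formal combination, so it can be computed term by term
  from the displayed sums in \<open>bd\<close>, whether or not displayed graphs coincide.\<close>

definition linear_extension ::
  "('k::field \<Rightarrow> 'c::ab_group_add \<Rightarrow> 'c) \<Rightarrow> ('g \<Rightarrow> 'c) \<Rightarrow> ('g \<Rightarrow>\<^sub>0 'k) \<Rightarrow> 'c" where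
  "linear_extension sc h p = (\<Sum>\<Gamma>\<in>Poly_Mapping.keys p. sc (Poly_Mapping.lookup p \<Gamma>) (h \<Gamma>))"

context vector_space
begin

lemma linear_extension_superset:
  assumes "finite A" "Poly_Mapping.keys p \<subseteq> A"
  shows "linear_extension scale h p = (\<Sum>\<Gamma>\<in>A. scale (Poly_Mapping.lookup p \<Gamma>) (h \<Gamma>))"
  unfolding linear_extension_def
  by (rule sum.mono_neutral_left) (use assms in \<open>auto simp: in_keys_iff\<close>)

lemma linear_extension_add:
  "linear_extension scale h (p + q) = linear_extension scale h p + linear_extension scale h q"
proof -
  let ?A = "Poly_Mapping.keys p \<union> Poly_Mapping.keys q"
  have "Poly_Mapping.keys (p + q) \<subseteq> ?A"
    by (rule Poly_Mapping.keys_add)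
  then show ?thesis
    by (simp add: linear_extension_superset[of ?A] lookup_add scale_left_distrib sum.distrib)
qed

lemma linear_extension_minus:
  "linear_extension scale h (p - q) = linear_extension scale h p - linear_extension scale h q"
  using linear_extension_add[of h "p - q" q] by simp

lemma linear_extension_zero [simp]: "linear_extension scale h 0 = 0"
  by (simp add: linear_extension_def)

lemma linear_extension_sum:
  "linear_extension scale h (\<Sum>i\<in>I. p i) = (\<Sum>i\<in>I. linear_extension scale h (p i))"
  by (induction I rule: infinite_finite_induct) (simp_all add: linear_extension_add)

lemma linear_extension_single [simp]:
  "linear_extension scale h (Poly_Mapping.single \<Gamma> c) = scale c (h \<Gamma>)"
  by (simp add: linear_extension_def)

text \<open>Serves all three two-vertex sums: those of \<open>Mu\<close> and \<open>Nu\<close>, and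
  the subtracted one of \<open>Fn\<close>.\<close>

lemma linear_extension_lie_part:
  assumes "\<And>i j \<sigma>. h (act (graft_first (a i) i (b j) j) \<sigma>) = 0"
  shows "linear_extension scale h (lie_part a b i0 n) = 0"
  by (simp add: lie_part_def linear_extension_sum assms split_beta)

end


section \<open>Placements of cochains on the vertices of a graph\<close>

definition placements :: "nat \<Rightarrow> ('e, 'x) graph \<Rightarrow> (nat \<Rightarrow> nat list) set" where
  "placements k \<Gamma> = {v \<in> {1..k} \<rightarrow>\<^sub>E vertices \<Gamma>. inj_on v {1..k}}"

lemma finite_vertices: "finite (vertices \<Gamma>)"
  by (induction \<Gamma> rule: vertices.induct) auto

lemma vertices_map_graph: "vertices (map_graph f \<sigma> \<Gamma>) = vertices \<Gamma>"
  by (induction \<Gamma> rule: vertices.induct) auto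

lemma vertices_act [simp]: "vertices (act \<Gamma> \<sigma>) = vertices \<Gamma>"
  by (simp add: act_def vertices_map_graph)

lemma vertices_corolla [simp]: "vertices (corolla e m n) = {[]}"
  by (auto simp: corolla_def nth_append)

text \<open>Legs carry no vertices, so among the children only the corolla at position 0
  contributes.\<close>

lemma vertices_graft_first: "vertices (graft_first a i b j) = {[], [0]}"
proof -
  have "vertices (Vertex a (t # map Leg ps)) = insert [] ((#) 0 ` vertices t)"
    for t :: "('a, nat) graph" and ps
    by (simp add: atLeast0_lessThan_Suc_eq_insert_0 image_image
        del: image_Suc_atLeastLessThan image_Suc_lessThan)
  then show ?thesis
    by (simp add: graft_first_def del: vertices.simps)
qed

lemma vertices_graft_all: "vertices (graft_all r) = insert [] ((\<lambda>i. [i]) ` {..<length r})"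
  by (auto simp: graft_all_def)

lemma placements_eq_empty:
  assumes "card (vertices \<Gamma>) < k"
  shows "placements k \<Gamma> = {}"
proof -
  have "\<not> inj_on v {1..k}" if "v \<in> {1..k} \<rightarrow>\<^sub>E vertices \<Gamma>" for v
    using card_inj_on_le[of v "{1..k}" "vertices \<Gamma>"] finite_vertices[of \<Gamma>] that assms by auto
  then show ?thesis
    by (auto simp: placements_def)
qed

lemma finite_placements: "finite (placements k \<Gamma>)"
  by (rule finite_subset[of _ "{1..k} \<rightarrow>\<^sub>E vertices \<Gamma>"])
    (auto simp: placements_def intro!: finite_PiE finite_vertices)

lemma placements_graft_first:
  assumes "3 \<le> k"
  shows "placements k (graft_first a i b j) = {}"
  using assms by (intro placements_eq_empty) (simp add: vertices_graft_first)

lemma placements_act [simp]: "placements k (act \<Gamma> \<sigma>) = placements k \<Gamma>"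
  by (simp add: placements_def)

lemma l_value_linear_extension:
  "l_value sc ev \<beta> k n F \<xi> = sc ((-1) ^ nu_exponent k n)
     (linear_extension sc (\<lambda>\<Gamma>. \<Sum>v\<in>placements k \<Gamma>. ev (insert_at \<beta> k F v \<Gamma>)) (bd \<xi>))"
  by (simp add: l_value_def linear_extension_def placements_def)

lemma (in vector_space) l_value_Mu_Nu:
  assumes "3 \<le> k"
  shows "l_value scale ev \<beta> k n F (Mu m) = 0" "l_value scale ev \<beta> k n F (Nu m) = 0"
  by (simp_all add: l_value_linear_extension linear_extension_lie_part
      placements_graft_first[OF assms])

section \<open>Summation over sorted compositions of all lengths\<close>

definition all_compositions :: "nat \<Rightarrow> nat list set" where
  "all_compositions m = {r. 2 \<le> length r \<and> (\<forall>x\<in>set r. 1 \<le> x) \<and> sum_list r = m \<and> sorted r}"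

lemma length_le_sum_list:
  fixes r :: "nat list"
  assumes "\<forall>x\<in>set r. Suc 0 \<le> x"
  shows "length r \<le> sum_list r"
  using assms by (induction r) auto

lemma finite_all_compositions: "finite (all_compositions m)"
proof (rule finite_subset)
  show "all_compositions m \<subseteq> {r. set r \<subseteq> {..m} \<and> length r \<le> m}"
    by (auto simp: all_compositions_def member_le_sum_list intro!: length_le_sum_list)
qed (simp add: finite_lists_length_le)

text \<open>Positive parts force \<open>length r \<le> m\<close>, so the upper bound on
  \<open>l\<close> cuts nothing off and the double sum is a single sum grouped by length.\<close>

lemma sum_compositions:
  "(\<Sum>l=2..m. \<Sum>r\<in>compositions l m. G r) = (\<Sum>r\<in>all_compositions m. G r)"
proof -
  have "compositions l m = {r \<in> all_compositions m. length r = l}" if "l \<in> {2..m}" for l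
    using that by (auto simp: compositions_def all_compositions_def)
  moreover have "length ` all_compositions m \<subseteq> {2..m}"
    by (auto simp: all_compositions_def intro: length_le_sum_list)
  ultimately show ?thesis
    using sum.group[OF finite_all_compositions, of "{2..m}" length m G] by simp
qed

lemma (in vector_space) l_value_Fn:
  assumes "3 \<le> k"
  shows "l_value scale ev \<beta> k n F (Fn m) = scale ((-1) ^ nu_exponent k n)
    (\<Sum>r\<in>all_compositions m. \<Sum>\<sigma>\<in>unshuffles_less r.
       scale ((-1) ^ block_exponent r * of_int (sign \<sigma>))
         (\<Sum>v\<in>placements k (graft_all r). ev (insert_at \<beta> k F v (act (graft_all r) \<sigma>))))"
  by (simp add: l_value_linear_extension linear_extension_minus linear_extension_lie_part
      placements_graft_first[OF assms] linear_extension_sum sum_compositions)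


section \<open>Evaluation of two-level graphs\<close>

text \<open>Applied both to the cochains themselves and to their degrees.\<close>

definition dec :: "'d \<Rightarrow> nat \<Rightarrow> (nat \<Rightarrow> 'd) \<Rightarrow> (nat \<Rightarrow> nat list) \<Rightarrow> nat list \<Rightarrow> 'd" where
  "dec \<beta> k F v p = (if p \<in> v ` {1..k} then F (inv_into {1..k} v p) else \<beta>)"

definition composite ::
  "(nat list \<Rightarrow> ('u, 'v) emap) \<Rightarrow> nat list \<Rightarrow> (nat \<Rightarrow> nat) \<Rightarrow> (nat \<Rightarrow> 'u) \<Rightarrow> 'v" where
  "composite D r \<sigma> x = at_nu (D []) (length r)
     (map (\<lambda>i. at_f (D [i]) (r ! i) (map (\<lambda>p. x (\<sigma> p)) [psum r i + 1..<psum r i + r ! i + 1]))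
       [0..<length r])"

lemma insert_at_dec: "insert_at \<beta> k F v \<Gamma> = redecorate (\<lambda>p. emap_app (dec \<beta> k F v p)) \<Gamma>"
  unfolding insert_at_def dec_def by (rule arg_cong[of _ _ "\<lambda>h. redecorate h \<Gamma>"]) auto

lemma gamma_W_graft_all:
  fixes x :: "nat \<Rightarrow> 'u::zero" and y :: "nat \<Rightarrow> 'v::zero"
  shows "gamma_W x y (redecorate (\<lambda>p. emap_app (D p)) (act (graft_all r) \<sigma>)) = composite D r \<sigma> x"
proof -
  \<comment> \<open>The decorating function \<open>h\<close> is arbitrary here, because redecorating
    a leg returns the same leg.\<close>
  have legs: "map (gamma_B x) (map (\<lambda>q. redecorate (h q) (map (map_graph id \<sigma>) (map Leg ps) ! q))
      [0..<length ps]) = map (\<lambda>p. x (\<sigma> p)) ps"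
    for ps and h :: "nat \<Rightarrow> nat list \<Rightarrow> gen \<Rightarrow> ('u, 'v) endo"
    by (rule nth_equalityI) simp_all
  \<comment> \<open>\<open>redecorate\<close> absorbs the path prefix into its function, so at a
    child the decoration is another map \<open>D'\<close>, with the vertex of the corolla at
    \<open>[]\<close>.\<close>
  have child: "gamma_W x y (redecorate (\<lambda>p. emap_app (D' p)) (map_graph id \<sigma> (corolla (Fn a) b c)))
      = at_f (D' []) a (map (\<lambda>p. x (\<sigma> p)) [b + 1..<b + c + 1])"
    for a b c and D' :: "nat list \<Rightarrow> ('u, 'v) emap"
    unfolding corolla_def graph.map redecorate.simps gamma_W.simps emap_app.simps endo.case
      id_apply length_map legs by (rule refl)
  show ?thesis
    unfolding graft_all_def act_def composite_def graph.map redecorate.simps gamma_W.simps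
      emap_app.simps endo.case id_apply length_map
    by (rule arg_cong[of _ _ "at_nu (D []) (length r)"], rule nth_equalityI)
      (simp_all add: child[unfolded id_def] del: upt_Suc)
qed


lemma multilinear_zero_arg:
  assumes "multilinear sA sB n \<phi>" "length xs = n" "i < n" "xs ! i = 0"
  shows "\<phi> xs = 0"
proof -
  have "Vector_Spaces.linear sA sB (\<lambda>x. \<phi> (xs[i := x]))"
    using assms by (simp add: multilinear_def)
  then have "module_hom sA sB (\<lambda>x. \<phi> (xs[i := x]))"
    by (simp add: Vector_Spaces.linear_def)
  then have "\<phi> (xs[i := 0]) = 0"
    by (rule module_hom.zero)
  then show ?thesis
    using assms(4) list_update_id[of xs i] by simp
qed

text \<open>Degree count: \<open>Nu l\<close> has degree \<open>l - 2\<close> and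
  \<open>Fn q\<close> has degree \<open>q - 1\<close>, so a map supported in degree
  \<open>p - 1\<close> can be nonzero only for \<open>l = p + 1\<close> and \<open>q = p\<close>. A
  vanishing child makes the multilinear value at the root vanish.\<close>

lemma composite_nonzero:
  assumes hom: "\<And>p. homogeneous sU sV (e p) (D p)"
    and r: "2 \<le> length r" "\<forall>x\<in>set r. 1 \<le> x"
    and nz: "composite D r \<sigma> x \<noteq> 0"
  shows "length r = e [] + 1" and "i < length r \<Longrightarrow> r ! i = e [i]"
proof -
  have "\<not> vanishes (length r) (at_nu (D []) (length r))"
  proof
    assume "vanishes (length r) (at_nu (D []) (length r))"
    then have "composite D r \<sigma> x = 0"
      unfolding vanishes_def composite_def by (elim allE impE) simp_all
    with nz show False ..
  qed
  then show "length r = e [] + 1"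
    using hom[of "[]"] r(1) by (auto simp: homogeneous_def)
  show "r ! i = e [i]" if i: "i < length r"
  proof (rule ccontr)
    assume "r ! i \<noteq> e [i]"
    then have "vanishes (r ! i) (at_f (D [i]) (r ! i))"
      using hom[of "[i]"] r(2) i by (auto simp: homogeneous_def)
    then have "at_f (D [i]) (r ! i)
        (map (\<lambda>p. x (\<sigma> p)) [psum r i + 1..<psum r i + r ! i + 1]) = 0"
      by (simp add: vanishes_def del: upt_Suc)
    moreover have ml: "multilinear sV sV (length r) (at_nu (D []) (length r))"
      using hom[of "[]"] r(1) by (auto simp: homogeneous_def)
    ultimately have "composite D r \<sigma> x = 0"
      unfolding composite_def using i
      by (intro multilinear_zero_arg[OF ml, of _ i]) (simp_all del: upt_Suc)
    with nz show False by simp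
  qed
qed

section \<open>Consecutive blocks of positions cut out by partial sums\<close>

lemma psum_Suc: "i < length r \<Longrightarrow> psum r (Suc i) = psum r i + r ! i"
  by (simp add: psum_def take_Suc_conv_app_nth)

lemma psum_mono: "i \<le> j \<Longrightarrow> psum r i \<le> psum r j"
  using take_add[of i "j - i" r] by (simp add: psum_def)

lemma psum_le: "psum r i \<le> sum_list r"
  using sum_list_append[of "take i r" "drop i r"] by (simp add: psum_def)

lemma block_exists:
  assumes "1 \<le> p" "p \<le> sum_list r"
  shows "\<exists>i<length r. psum r i < p \<and> p \<le> psum r i + r ! i"
proof -
  let ?P = "\<lambda>i. p \<le> psum r i"
  \<comment> \<open>\<open>i\<close> is the first partial sum reaching \<open>p\<close>. It is
    positive because \<open>p \<ge> 1\<close>, and its predecessor is the block sought.\<close>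
  define i where "i = (LEAST i. ?P i)"
  have "?P (length r)"
    using assms by (simp add: psum_def)
  then have P: "?P i" and le: "i \<le> length r"
    unfolding i_def by (rule LeastI, rule Least_le)
  obtain j where j: "i = Suc j"
    using P assms(1) by (cases i) (auto simp: psum_def)
  have "\<not> ?P j"
    using not_less_Least[of j ?P] j by (simp add: i_def)
  then show ?thesis
    using P le j psum_Suc[of j r] by (intro exI[of _ j]) auto
qed

lemma block_unique:
  assumes "i < length r" "j < length r"
    and "psum r i < p" "p \<le> psum r i + r ! i" "psum r j < p" "p \<le> psum r j + r ! j"
  shows "i = j"
proof (rule ccontr)
  assume "i \<noteq> j"
  then consider "Suc i \<le> j" | "Suc j \<le> i"
    by linarith
  then show False
    using psum_mono[of "Suc i" j r] psum_mono[of "Suc j" i r] psum_Suc[of i r] psum_Suc[of j r] assms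
    by cases auto
qed

text \<open>Since \<open>\<sigma>\<close> is a bijection and the blocks are disjoint, each input
  enters exactly one child in exactly one slot. In that input the composite is a linear map of the
  child followed by a linear map of the root.\<close>

lemma multilinear_composite:
  assumes hom: "\<And>p. homogeneous sU sV (e p) (D p)"
    and r: "2 \<le> length r" "\<forall>x\<in>set r. 1 \<le> x" "sum_list r = m"
    and \<sigma>: "\<sigma> permutes {1..m}"
  shows "multilinear sU sV m (\<lambda>xs. composite D r \<sigma> (inputs xs))"
  unfolding multilinear_def
proof (intro allI impI)
  fix xs :: "'b list" and q
  assume xs: "length xs = m" and q: "q < m"
  \<comment> \<open>The leg fed by list position \<open>q\<close>; legs and values of
    \<open>\<sigma>\<close> count from 1, hence \<open>Suc q\<close>.\<close>
  define p where "p = inv \<sigma> (Suc q)"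
  have \<sigma>p: "\<sigma> p = Suc q"
    using permutes_inverses[OF \<sigma>] by (simp add: p_def)
  have "p \<in> {1..m}"
    using permutes_in_image[OF \<sigma>, of p] q \<sigma>p by simp
  then obtain i where i: "i < length r" "psum r i < p" "p \<le> psum r i + r ! i"
    using block_exists[of p r] r(3) by auto
  \<comment> \<open>The list position of leg \<open>p\<close> inside its block \<open>i\<close>,
    counted from 0.\<close>
  define c where "c = p - psum r i - 1"
  define B where "B j ys = map (\<lambda>p. inputs ys (\<sigma> p)) [psum r j + 1..<psum r j + r ! j + 1]" for j and ys :: "'b list"
  define zs where "zs = map (\<lambda>j. at_f (D [j]) (r ! j) (B j xs)) [0..<length r]"
  have c: "c < r ! i"
    using i by (auto simp: c_def)
  have le: "psum r j + r ! j \<le> m" if "j < length r" for j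
    using psum_Suc[OF that] psum_le[of r "Suc j"] r(3) by simp
  have upd: "inputs (xs[q := x]) (\<sigma> p') = (if p' = p then x else inputs xs (\<sigma> p'))"
    if "p' \<in> {1..m}" for p' x
  proof -
    have "\<sigma> p' \<in> {1..m}"
      using permutes_in_image[OF \<sigma>, of p'] that by simp
    moreover have "\<sigma> p' = \<sigma> p \<longleftrightarrow> p' = p"
      using permutes_inj[OF \<sigma>] by (auto dest: injD)
    ultimately show ?thesis
      using xs q \<sigma>p by (auto simp: inputs_def nth_list_update)
  qed
  \<comment> \<open>Only the block containing \<open>p\<close> sees the update;
    \<open>block_unique\<close> excludes the others.\<close>
  have B: "B j (xs[q := x]) = (if j = i then (B i xs)[c := x] else B j xs)" if j: "j < length r" for j x
  proof (rule nth_equalityI)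
    show "length (B j (xs[q := x])) = length (if j = i then (B i xs)[c := x] else B j xs)"
      by (auto simp: B_def simp del: upt_Suc)
    fix d assume "d < length (B j (xs[q := x]))"
    then have d: "d < r ! j"
      by (simp add: B_def del: upt_Suc)
    have "B j (xs[q := x]) ! d
        = (if psum r j + 1 + d = p then x else inputs xs (\<sigma> (psum r j + 1 + d)))"
      unfolding B_def using d le[OF j] upd[of "psum r j + 1 + d" x] by (simp del: upt_Suc)
    also have "\<dots> = (if j = i then (B i xs)[c := x] else B j xs) ! d"
    proof (cases "j = i")
      case True
      then show ?thesis
        using d i c by (auto simp: B_def c_def nth_list_update simp del: upt_Suc)
    next
      case False
      then have "psum r j + 1 + d \<noteq> p"
        using block_unique[of i r j p] i j d by auto
      then show ?thesis
        using False d by (auto simp: B_def simp del: upt_Suc)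
    qed
    finally show "B j (xs[q := x]) ! d = (if j = i then (B i xs)[c := x] else B j xs) ! d" .
  qed
  have "composite D r \<sigma> (inputs (xs[q := x]))
      = at_nu (D []) (length r) (zs[i := at_f (D [i]) (r ! i) ((B i xs)[c := x])])" for x
  proof -
    have "map (\<lambda>j. at_f (D [j]) (r ! j) (B j (xs[q := x]))) [0..<length r]
        = zs[i := at_f (D [i]) (r ! i) ((B i xs)[c := x])]"
      by (rule nth_equalityI) (auto simp: zs_def B nth_list_update)
    then show ?thesis
      by (simp add: composite_def B_def del: upt_Suc)
  qed
  moreover have "Vector_Spaces.linear sV sV (\<lambda>y. at_nu (D []) (length r) (zs[i := y]))"
    using hom[of "[]"] r(1) i(1) by (auto simp: homogeneous_def multilinear_def zs_def)
  moreover have "Vector_Spaces.linear sU sV (\<lambda>x. at_f (D [i]) (r ! i) ((B i xs)[c := x]))"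
    using hom[of "[i]"] r(2) i(1) c
    by (auto simp: homogeneous_def multilinear_def B_def simp del: upt_Suc)
  ultimately show "Vector_Spaces.linear sU sV (\<lambda>x. composite D r \<sigma> (inputs (xs[q := x])))"
    using Vector_Spaces.linear_compose[of sU sV "\<lambda>x. at_f (D [i]) (r ! i) ((B i xs)[c := x])"
        sV "\<lambda>y. at_nu (D []) (length r) (zs[i := y])"]
    by (simp add: o_def)
qed


section \<open>The value of \<open>l\<^sub>k\<close> on the generators\<close>

text \<open>The root arity \<open>l\<close> is kept free and no order is imposed:
  \<open>l = n s + 1\<close> and admissibility emerge only after the zero summands are
  discarded.\<close>

definition tuples :: "nat \<Rightarrow> nat \<Rightarrow> nat \<Rightarrow> (nat \<Rightarrow> nat) set" where
  "tuples k s l = {a \<in> ({1..k} - {s}) \<rightarrow>\<^sub>E {1..l}. inj_on a ({1..k} - {s})}"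

text \<open>The points \<open>a\<^sub>j\<close> count the inputs of the root from 1, the addresses of vertices from 0.\<close>

definition place :: "nat \<Rightarrow> nat \<Rightarrow> (nat \<Rightarrow> nat) \<Rightarrow> nat \<Rightarrow> nat list" where
  "place k s a = (\<lambda>j\<in>{1..k}. if j = s then [] else [a j - 1])"

lemma finite_tuples: "finite (tuples k s l)"
  by (rule finite_subset[of _ "({1..k} - {s}) \<rightarrow>\<^sub>E {1..l}"])
    (auto simp: tuples_def intro!: finite_PiE)

text \<open>The lower bound makes \<open>a j - 1\<close> in \<open>place\<close> a true subtraction,
  so passing from points to addresses loses no information.\<close>

lemma tuples_ge_1: "a \<in> tuples k s l \<Longrightarrow> j \<in> {1..k} - {s} \<Longrightarrow> 1 \<le> a j \<and> a j \<le> l"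
  using PiE_mem[of a "{1..k} - {s}" "\<lambda>_. {1..l}" j] by (simp add: tuples_def)

lemma place_in_placements:
  assumes "a \<in> tuples k s (length r)"
  shows "place k s a \<in> placements k (graft_all r)"
proof -
  have "place k s a \<in> {1..k} \<rightarrow>\<^sub>E vertices (graft_all r)"
    unfolding place_def vertices_graft_all restrict_PiE_iff
  proof (intro ballI)
    fix j assume "j \<in> {1..k}"
    then show "(if j = s then [] else [a j - 1]) \<in> insert [] ((\<lambda>i. [i]) ` {..<length r})"
      using tuples_ge_1[OF assms, of j] by (auto intro!: imageI)
  qed
  moreover have "inj_on (place k s a) {1..k}"
  proof (rule inj_onI)
    fix i j assume ij: "i \<in> {1..k}" "j \<in> {1..k}" "place k s a i = place k s a j"
    show "i = j"
    proof (cases "i = s \<or> j = s")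
      case True
      with ij show ?thesis by (auto simp: place_def split: if_splits)
    next
      case False
      with ij have "a i - 1 = a j - 1" by (simp add: place_def)
      then have "a i = a j"
        using tuples_ge_1[OF assms, of i] tuples_ge_1[OF assms, of j] ij False by auto
      moreover have "inj_on a ({1..k} - {s})"
        using assms by (simp add: tuples_def)
      ultimately show ?thesis
        using ij False by (simp add: inj_on_eq_iff)
    qed
  qed
  ultimately show ?thesis
    by (simp add: placements_def)
qed

lemma dec_at:
  assumes "inj_on v {1..k}" "j \<in> {1..k}"
  shows "dec d k F v (v j) = F j"
  using assms by (simp add: dec_def)

lemma dec_place_root:
  assumes "s \<in> {1..k}" "a \<in> tuples k s l"
  shows "dec d k F (place k s a) [] = F s"
proof -
  have "inj_on (place k s a) {1..k}"
    \<comment> \<open>\<open>replicate l 0\<close> is just some list of length \<open>l\<close>; the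
      vertices of \<open>graft_all\<close> depend on the length alone.\<close>
    using place_in_placements[of a k s "replicate l 0"] assms(2) by (simp add: placements_def)
  from dec_at[OF this assms(1), of d F] show ?thesis
    using assms(1) by (simp add: place_def)
qed

text \<open>Expresses the decoration of a child by the same case distinction on the point
  \<open>Suc i\<close> as in \<open>block_sizes\<close> and \<open>gen_comp\<close>.\<close>

lemma dec_place_child:
  assumes a: "a \<in> tuples k s l"
  shows "dec d k F (place k s a) [i] =
    (if Suc i \<in> a ` ({1..k} - {s}) then F (inv_into ({1..k} - {s}) a (Suc i)) else d)"
proof (cases "Suc i \<in> a ` ({1..k} - {s})")
  case True
  then obtain j where j: "j \<in> {1..k} - {s}" "a j = Suc i"
    by (metis imageE)
  have "inj_on (place k s a) {1..k}"
    using place_in_placements[of a k s "replicate l 0"] a by (simp add: placements_def)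
  from dec_at[OF this, of j d F] have "dec d k F (place k s a) [i] = F j"
    using j by (simp add: place_def)
  moreover have "inv_into ({1..k} - {s}) a (Suc i) = j"
    using a j by (metis (mono_tags, lifting) inv_into_f_f mem_Collect_eq tuples_def)
  ultimately show ?thesis
    using True by simp
next
  case False
  have "[i] \<notin> place k s a ` {1..k}"
  proof
    assume "[i] \<in> place k s a ` {1..k}"
    then obtain j where "j \<in> {1..k} - {s}" "a j - 1 = i"
      by (auto simp: place_def split: if_splits)
    then show False
      using False tuples_ge_1[OF a, of j] by (metis Suc_diff_1 imageI less_eq_Suc_le One_nat_def)
  qed
  then show ?thesis
    using False by (simp add: dec_def)
qed

text \<open>A placement hitting the root amounts to a pair: the index \<open>s\<close> of the
  cochain at the root, and the positions of the others among the children. The assumption removes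
  the placements that leave the root free.\<close>

lemma sum_placements:
  assumes "\<And>v. v \<in> placements k (graft_all r) \<Longrightarrow> [] \<notin> v ` {1..k} \<Longrightarrow> h v = (0::'c::comm_monoid_add)"
  shows "(\<Sum>v\<in>placements k (graft_all r). h v)
    = (\<Sum>s=1..k. \<Sum>a\<in>tuples k s (length r). h (place k s a))"
proof -
  let ?P = "{v \<in> placements k (graft_all r). [] \<in> v ` {1..k}}"
  let ?Q = "SIGMA s:{1..k}. tuples k s (length r)"
  define root where "root v = inv_into {1..k} v []" for v :: "nat \<Rightarrow> nat list"
  define child where "child v = (\<lambda>j\<in>{1..k} - {root v}. Suc (hd (v j)))" for v :: "nat \<Rightarrow> nat list"
  have root: "root v \<in> {1..k}" "v (root v) = []" if "v \<in> ?P" for v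
    using that by (auto simp: root_def inv_into_into f_inv_into_f simp del: atLeastAtMost_iff)
  \<comment> \<open>By injectivity only the index \<open>root v\<close> is sent to
    \<open>[]\<close>, so every other index goes to a child of the root.\<close>
  have leaf: "\<exists>i<length r. v j = [i]" if v: "v \<in> ?P" and j: "j \<in> {1..k} - {root v}" for v j
  proof -
    have "v j \<in> vertices (graft_all r)"
      using v j by (auto simp: placements_def)
    moreover have "v j \<noteq> []"
      using root[OF v] v j inj_onD[of v "{1..k}" j "root v"] by (auto simp: placements_def)
    ultimately show ?thesis
      by (auto simp: vertices_graft_all)
  qed
  have "(\<Sum>v\<in>placements k (graft_all r). h v) = (\<Sum>v\<in>?P. h v)"
    by (rule sum.mono_neutral_right) (use assms finite_placements in auto)
  also have "\<dots> = (\<Sum>(s, a)\<in>?Q. h (place k s a))"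
  proof (rule sum.reindex_bij_witness[where i = "\<lambda>(s, a). place k s a" and j = "\<lambda>v. (root v, child v)"])
    fix v assume v: "v \<in> ?P"
    show *: "(case (root v, child v) of (s, a) \<Rightarrow> place k s a) = v"
    proof (rule ext)
      fix j
      show "(case (root v, child v) of (s, a) \<Rightarrow> place k s a) j = v j"
      proof (cases "j \<in> {1..k} - {root v}")
        case True
        then show ?thesis
          using leaf[OF v True] by (auto simp: place_def child_def)
      next
        case False
        then show ?thesis
          using root[OF v] v by (auto simp: place_def placements_def PiE_def extensional_def)
      qed
    qed
    then show "(case (root v, child v) of (s, a) \<Rightarrow> h (place k s a)) = h v"
      by simp
    have "child v j \<in> {1..length r}" if "j \<in> {1..k} - {root v}" for j
      using leaf[OF v that] that by (auto simp: child_def)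
    moreover have "inj_on (child v) ({1..k} - {root v})"
    proof (rule inj_onI)
      fix i j assume ij: "i \<in> {1..k} - {root v}" "j \<in> {1..k} - {root v}" "child v i = child v j"
      then have "v i = v j"
        using leaf[OF v ij(1)] leaf[OF v ij(2)] by (auto simp: child_def)
      moreover have "inj_on v {1..k}"
        using v by (simp add: placements_def)
      ultimately show "i = j"
        using ij by (simp add: inj_on_eq_iff)
    qed
    ultimately have "child v \<in> tuples k (root v) (length r)"
      by (auto simp: tuples_def child_def)
    then show "(root v, child v) \<in> ?Q"
      using root[OF v] by simp
  next
    fix sa assume "sa \<in> ?Q"
    then obtain s a where sa: "sa = (s, a)" "s \<in> {1..k}" "a \<in> tuples k s (length r)"
      by auto
    note p = place_in_placements[OF sa(3)]
    have s: "place k s a s = []"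
      using sa by (simp add: place_def)
    then show "(case sa of (s, a) \<Rightarrow> place k s a) \<in> ?P"
      using p sa(1) image_eqI[where f = "place k s a", OF s[symmetric] sa(2)] by simp
    have "root (place k s a) = s"
      using inv_into_f_f[of "place k s a" "{1..k}" s] p s sa(2)
      by (simp add: root_def placements_def)
    \<comment> \<open>The equation fixes the index set \<open>{1..k} - {s}\<close> on which
      \<open>child\<close> is defined.\<close>
    moreover have "child (place k s a) = a" if "root (place k s a) = s"
    proof (rule ext)
      fix j
      show "child (place k s a) j = a j"
        using that tuples_ge_1[OF sa(3), of j] sa(3)
        by (cases "j \<in> {1..k} - {s}")
          (auto simp: child_def place_def tuples_def PiE_def extensional_def)
    qed
    ultimately show "(root (case sa of (s, a) \<Rightarrow> place k s a), child (case sa of (s, a) \<Rightarrow> place k s a)) = sa"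
      by (simp add: sa(1))
  qed
  also have "\<dots> = (\<Sum>s=1..k. \<Sum>a\<in>tuples k s (length r). h (place k s a))"
    by (rule sum.Sigma[symmetric]) (auto intro: finite_tuples)
  finally show ?thesis .
qed

section \<open>Block sizes attached to a tuple of points\<close>

lemma length_block_sizes [simp]: "length (block_sizes k n s a) = n s + 1"
  by (simp add: block_sizes_def del: upt_Suc)

text \<open>Block sizes are the decorations with cochains replaced by their degrees; the default 1
  is the degree of \<open>\<beta>\<close>.\<close>

lemma nth_block_sizes:
  assumes "a \<in> tuples k s l" "i < n s + 1"
  shows "block_sizes k n s a ! i = dec 1 k n (place k s a) [i]"
  unfolding dec_place_child[OF assms(1)] using assms(2)
  by (simp add: block_sizes_def del: upt_Suc)

lemma admissible_eq: "admissible k n s = {a \<in> tuples k s (n s + 1). sorted (block_sizes k n s a)}"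
  by (auto simp: admissible_def tuples_def)

lemma sum_image_inv_into:
  assumes "inj_on a K"
  shows "(\<Sum>i\<in>a ` K. if i \<in> a ` K then f (inv_into K a i) else c) = sum f K"
  using assms by (simp add: sum.reindex)

text \<open>The \<open>k - 1\<close> chosen points contribute the degrees \<open>n j\<close> with
  \<open>j \<noteq> s\<close>, and each of the other \<open>n s + 2 - k\<close> points contributes
  1.\<close>

lemma sum_list_block_sizes:
  assumes s: "s \<in> {1..k}" and a: "a \<in> tuples k s (n s + 1)"
  shows "int (sum_list (block_sizes k n s a)) = - int k + 2 + (\<Sum>s=1..k. int (n s))"
proof -
  let ?K = "{1..k} - {s}"
  let ?f = "\<lambda>i. if i \<in> a ` ?K then n (inv_into ?K a i) else 1"
  have inj: "inj_on a ?K" and sub: "a ` ?K \<subseteq> {1..n s + 1}"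
    using a by (auto simp: tuples_def)
  have card: "card (a ` ?K) = k - 1" and K: "1 \<le> k"
    using card_image[OF inj] s by auto
  have "sum_list (block_sizes k n s a) = (\<Sum>i\<in>{1..n s + 1}. ?f i)"
    by (simp add: block_sizes_def interv_sum_list_conv_sum_set_nat atLeastLessThanSuc_atLeastAtMost
        del: upt_Suc)
  also have "\<dots> = (\<Sum>i\<in>a ` ?K. ?f i) + (\<Sum>i\<in>{1..n s + 1} - a ` ?K. ?f i)"
    using sum.subset_diff[OF sub, of ?f] by simp
  also have "(\<Sum>i\<in>a ` ?K. ?f i) = (\<Sum>j\<in>?K. n j)"
    using sum_image_inv_into[OF inj, of n 1] .
  also have "(\<Sum>i\<in>{1..n s + 1} - a ` ?K. ?f i) = card ({1..n s + 1} - a ` ?K)"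
    by simp
  also have "\<dots> = n s + 1 - (k - 1)"
    using card card_Diff_subset[OF _ sub] by simp
  finally have "sum_list (block_sizes k n s a) = (\<Sum>j\<in>?K. n j) + (n s + 1 - (k - 1))" .
  \<comment> \<open>Injectivity of \<open>a\<close> ensures that the natural-number subtraction
    above is not truncated.\<close>
  moreover have "k - 1 \<le> n s + 1"
    using card card_mono[OF _ sub] by simp
  moreover have "(\<Sum>j=1..k. int (n j)) = int (n s) + (\<Sum>j\<in>?K. int (n j))"
    using s by (intro sum.remove) auto
  ultimately show ?thesis
    using K by simp
qed


section \<open>Sums and multiples of linear maps\<close>

lemma linear_sum:
  assumes "vector_space sA" "vector_space sB"
    and "\<And>i. i \<in> I \<Longrightarrow> Vector_Spaces.linear sA sB (f i)"
  shows "Vector_Spaces.linear sA sB (\<lambda>x. \<Sum>i\<in>I. f i x)"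
proof -
  interpret A: vector_space sA by fact
  interpret B: vector_space sB by fact
  interpret vector_space_pair sA sB ..
  show ?thesis
    using assms(3) by (intro linear_compose_sum) auto
qed

lemma multilinear_zero:
  assumes "vector_space sA" "vector_space sB"
  shows "multilinear sA sB m (\<lambda>_. 0)"
  \<comment> \<open>The zero map is the empty sum.\<close>
  using linear_sum[OF assms, of "{}"] by (simp add: multilinear_def)

lemma linear_scale:
  assumes "vector_space sA" "vector_space sB" "Vector_Spaces.linear sA sB f"
  shows "Vector_Spaces.linear sA sB (\<lambda>x. sB c (f x))"
proof -
  interpret A: vector_space sA by fact
  interpret B: vector_space sB by fact
  interpret vector_space_pair sA sB ..
  show ?thesis
    using assms(3) by (intro linear_compose_scale_right)
qed

section \<open>Reduction to admissible tuples for a family of cochains\<close>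

text \<open>\<open>\<beta>\<close> is handled like one more cochain, of degree 1: by homogeneity it
  vanishes on all generators except \<open>Mu 2\<close>, \<open>Nu 2\<close> and
  \<open>Fn 1\<close>.\<close>

locale cochain_family =
  fixes sU :: "'k::field \<Rightarrow> 'u::ab_group_add \<Rightarrow> 'u"
    and sV :: "'k \<Rightarrow> 'v::ab_group_add \<Rightarrow> 'v"
    and \<beta> :: "('u, 'v) emap"
    and k :: nat and n :: "nat \<Rightarrow> nat" and \<theta> :: "nat \<Rightarrow> ('u, 'v) emap"
  assumes vector_space_U: "vector_space sU"
    and vector_space_V: "vector_space sV"
    and homogeneous_beta: "homogeneous sU sV 1 \<beta>"
    and three_le: "3 \<le> k"
    and ge_1: "s \<in> {1..k} \<Longrightarrow> 1 \<le> n s"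
    and homogeneous_family: "s \<in> {1..k} \<Longrightarrow> homogeneous sU sV (n s) (\<theta> s)"
begin

sublocale U: vector_space sU by (rule vector_space_U)
sublocale V: vector_space sV by (rule vector_space_V)

text \<open>Decorating with degrees in parallel to cochains supplies the degree function required by
  \<open>composite_nonzero\<close>.\<close>

lemma homogeneous_dec: "homogeneous sU sV (dec 1 k n v p) (dec \<beta> k \<theta> v p)"
proof (cases "p \<in> v ` {1..k}")
  case True
  then have "inv_into {1..k} v p \<in> {1..k}"
    by (rule inv_into_into)
  from homogeneous_family[OF this] True show ?thesis
    by (simp add: dec_def)
next
  case False
  then show ?thesis
    using homogeneous_beta by (simp add: dec_def)
qed

lemma all_compositionsD:
  assumes "r \<in> all_compositions m"
  shows "2 \<le> length r" "\<forall>x\<in>set r. 1 \<le> x" "sum_list r = m" "sorted r"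
  using assms by (auto simp: all_compositions_def)

lemma composite_root_not_hit:
  assumes r: "r \<in> all_compositions m" and v: "v \<in> placements k (graft_all r)"
    and root: "[] \<notin> v ` {1..k}"
  shows "composite (dec \<beta> k \<theta> v) r \<sigma> x = 0"
proof (rule ccontr)
  assume "composite (dec \<beta> k \<theta> v) r \<sigma> x \<noteq> 0"
  from composite_nonzero(1)[OF homogeneous_dec all_compositionsD(1,2)[OF r] this]
  \<comment> \<open>The root carries \<open>\<beta>\<close>, so its arity is 1 + 1. The remaining
    steps count: \<open>k \<ge> 3\<close> distinct vertices do not fit on two children.\<close>
  have l: "length r = 2"
    using root by (simp add: dec_def)
  have "v ` {1..k} \<subseteq> vertices (graft_all r)"
    using v by (auto simp: placements_def)
  then have "v ` {1..k} \<subseteq> (\<lambda>i. [i]) ` {..<length r}"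
    unfolding vertices_graft_all subset_insert[OF root] .
  then have "card (v ` {1..k}) \<le> card ((\<lambda>i. [i]) ` {..<length r})"
    by (intro card_mono) simp_all
  also have "\<dots> \<le> length r"
    using card_image_le[of "{..<length r}" "\<lambda>i. [i]"] by simp
  finally have "card (v ` {1..k}) \<le> 2"
    by (simp add: l)
  moreover have "card (v ` {1..k}) = k"
    using v card_image[of v "{1..k}"] by (simp add: placements_def)
  ultimately show False
    using three_le by simp
qed

lemma composite_place_nonzero:
  assumes r: "r \<in> all_compositions m" and s: "s \<in> {1..k}" and a: "a \<in> tuples k s (length r)"
    and nz: "composite (dec \<beta> k \<theta> (place k s a)) r \<sigma> x \<noteq> 0"
  shows "length r = n s + 1" "r = block_sizes k n s a"
proof -
  note * = composite_nonzero[OF homogeneous_dec all_compositionsD(1,2)[OF r] nz]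
  show l: "length r = n s + 1"
    using *(1) dec_place_root[OF s a] by simp
  show "r = block_sizes k n s a"
    by (rule nth_equalityI) (simp_all add: l *(2) nth_block_sizes[OF a])
qed

text \<open>The positive degrees of the cochains give positive parts, and \<open>n s \<ge> 1\<close>
  gives at least two of them.\<close>

lemma block_sizes_in_all_compositions:
  assumes s: "s \<in> {1..k}" and a: "a \<in> admissible k n s"
  shows "block_sizes k n s a \<in> all_compositions (sum_list (block_sizes k n s a))"
proof -
  have a': "a \<in> tuples k s (n s + 1)" and "sorted (block_sizes k n s a)"
    using a by (simp_all add: admissible_eq)
  moreover have "1 \<le> block_sizes k n s a ! i" if "i < n s + 1" for i
  proof -
    have "1 \<le> dec 1 k n v p" for v p
      unfolding dec_def using ge_1 inv_into_into[of p v "{1..k}"] by (cases "p \<in> v ` {1..k}") auto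
    then show ?thesis
      by (simp add: nth_block_sizes[where n = n, OF a' that])
  qed
  ultimately show ?thesis
    using ge_1[OF s] by (auto simp: all_compositions_def in_set_conv_nth simp del: One_nat_def)
qed

text \<open>Nonzero summands lie on the graph of \<open>a \<mapsto> block_sizes k n s a\<close>, and
  sortedness of \<open>r\<close> then says that \<open>a\<close> is admissible. Since
  \<open>m\<close> is arbitrary, the condition on the total size stays.\<close>

lemma sum_tuples:
  fixes G :: "nat list \<Rightarrow> (nat \<Rightarrow> nat) \<Rightarrow> 'v"
  assumes s: "s \<in> {1..k}"
    and G: "\<And>r a. r \<in> all_compositions m \<Longrightarrow> a \<in> tuples k s (length r) \<Longrightarrow> G r a \<noteq> 0 \<Longrightarrow>
      length r = n s + 1 \<and> r = block_sizes k n s a"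
  shows "(\<Sum>r\<in>all_compositions m. \<Sum>a\<in>tuples k s (length r). G r a)
    = (\<Sum>a\<in>{a \<in> admissible k n s. sum_list (block_sizes k n s a) = m}. G (block_sizes k n s a) a)"
proof -
  let ?A = "{a \<in> admissible k n s. sum_list (block_sizes k n s a) = m}"
  let ?f = "\<lambda>a. (block_sizes k n s a, a)"
  let ?S = "SIGMA r:all_compositions m. tuples k s (length r)"
  have "(\<Sum>r\<in>all_compositions m. \<Sum>a\<in>tuples k s (length r). G r a) = (\<Sum>(r, a)\<in>?S. G r a)"
    by (rule sum.Sigma) (simp_all add: finite_all_compositions finite_tuples)
  also have "\<dots> = (\<Sum>(r, a)\<in>?f ` ?A. G r a)"
  proof (rule sum.mono_neutral_right)
    show "finite ?S"
      by (simp add: finite_all_compositions finite_tuples)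
    show "?f ` ?A \<subseteq> ?S"
    proof
      fix z assume "z \<in> ?f ` ?A"
      then obtain a where a: "a \<in> admissible k n s" "sum_list (block_sizes k n s a) = m" "z = ?f a"
        by blast
      then show "z \<in> ?S"
        using block_sizes_in_all_compositions[OF s a(1)] by (simp add: admissible_eq)
    qed
    show "\<forall>z\<in>?S - ?f ` ?A. (case z of (r, a) \<Rightarrow> G r a) = 0"
    proof (rule ballI, rule ccontr)
      fix z assume z: "z \<in> ?S - ?f ` ?A" and nz: "(case z of (r, a) \<Rightarrow> G r a) \<noteq> 0"
      obtain r a where ra: "z = (r, a)" "r \<in> all_compositions m" "a \<in> tuples k s (length r)"
        using z by auto
      have "length r = n s + 1" and r: "r = block_sizes k n s a"
        using G[OF ra(2,3)] nz ra(1) by simp_all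
      then have "a \<in> admissible k n s" "sum_list (block_sizes k n s a) = m"
        using ra(3) all_compositionsD[OF ra(2)] by (simp_all add: admissible_eq)
      then have "z \<in> ?f ` ?A"
        using ra(1) r by blast
      with z show False by simp
    qed
  qed
  also have "\<dots> = (\<Sum>a\<in>?A. G (block_sizes k n s a) a)"
    by (subst sum.reindex) (simp_all add: inj_on_def)
  finally show ?thesis .
qed

lemma l_value_Fn_composite:
  "l_value sV (gamma_W x y) \<beta> k n \<theta> (Fn m) = sV ((-1) ^ nu_exponent k n)
    (\<Sum>r\<in>all_compositions m. \<Sum>\<sigma>\<in>unshuffles_less r.
       sV ((-1) ^ block_exponent r * of_int (sign \<sigma>))
         (\<Sum>v\<in>placements k (graft_all r). composite (dec \<beta> k \<theta> v) r \<sigma> x))"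
  by (simp add: V.l_value_Fn[OF three_le] insert_at_dec gamma_W_graft_all)

text \<open>Keeping \<open>m\<close> arbitrary lets one formula yield both the vanishing on
  \<open>Fn m\<close> for \<open>m \<noteq> t\<close> and the value on \<open>Fn t\<close>.\<close>

lemma l_value_Fn_admissible:
  "l_value sV (gamma_W x y) \<beta> k n \<theta> (Fn m) = sV ((-1) ^ nu_exponent k n)
    (\<Sum>s=1..k. \<Sum>a\<in>{a \<in> admissible k n s. sum_list (block_sizes k n s a) = m}.
       \<Sum>\<sigma>\<in>unshuffles_less (block_sizes k n s a).
         sV (of_int (sign \<sigma>) * (-1) ^ block_exponent (block_sizes k n s a))
           (composite (dec \<beta> k \<theta> (place k s a)) (block_sizes k n s a) \<sigma> x))"
proof -
  let ?c = "\<lambda>r \<sigma>. of_int (sign \<sigma>) * (-1) ^ block_exponent r"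
  let ?t = "\<lambda>s r a \<sigma>. sV (?c r \<sigma>) (composite (dec \<beta> k \<theta> (place k s a)) r \<sigma> x)"
  let ?G = "\<lambda>s r a. \<Sum>\<sigma>\<in>unshuffles_less r. ?t s r a \<sigma>"
  have "(\<Sum>\<sigma>\<in>unshuffles_less r. sV (?c r \<sigma>)
          (\<Sum>v\<in>placements k (graft_all r). composite (dec \<beta> k \<theta> v) r \<sigma> x))
      = (\<Sum>s=1..k. \<Sum>a\<in>tuples k s (length r). ?G s r a)" if r: "r \<in> all_compositions m" for r
  proof -
    have "(\<Sum>v\<in>placements k (graft_all r). composite (dec \<beta> k \<theta> v) r \<sigma> x)
        = (\<Sum>s=1..k. \<Sum>a\<in>tuples k s (length r). composite (dec \<beta> k \<theta> (place k s a)) r \<sigma> x)"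
      for \<sigma>
      by (rule sum_placements) (rule composite_root_not_hit[OF r])
    then have "(\<Sum>\<sigma>\<in>unshuffles_less r. sV (?c r \<sigma>)
          (\<Sum>v\<in>placements k (graft_all r). composite (dec \<beta> k \<theta> v) r \<sigma> x))
        = (\<Sum>\<sigma>\<in>unshuffles_less r. \<Sum>s=1..k. \<Sum>a\<in>tuples k s (length r). ?t s r a \<sigma>)"
      by (simp only: V.scale_sum_right)
    also have "\<dots> = (\<Sum>s=1..k. \<Sum>\<sigma>\<in>unshuffles_less r. \<Sum>a\<in>tuples k s (length r). ?t s r a \<sigma>)"
      by (rule sum.swap)
    also have "\<dots> = (\<Sum>s=1..k. \<Sum>a\<in>tuples k s (length r). ?G s r a)"
      \<comment> \<open>The sum over \<open>\<sigma>\<close> becomes innermost, since its range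
        depends on \<open>r\<close>, which is about to be replaced by the block sizes of
        \<open>a\<close>.\<close>
      by (intro sum.cong refl sum.swap)
    finally show ?thesis .
  qed
  then have "(\<Sum>r\<in>all_compositions m. \<Sum>\<sigma>\<in>unshuffles_less r. sV (?c r \<sigma>)
        (\<Sum>v\<in>placements k (graft_all r). composite (dec \<beta> k \<theta> v) r \<sigma> x))
      = (\<Sum>r\<in>all_compositions m. \<Sum>s=1..k. \<Sum>a\<in>tuples k s (length r). ?G s r a)"
    by (intro sum.cong refl)
  also have "\<dots> = (\<Sum>s=1..k. \<Sum>r\<in>all_compositions m. \<Sum>a\<in>tuples k s (length r). ?G s r a)"
    by (rule sum.swap)
  also have "\<dots> = (\<Sum>s=1..k. \<Sum>a\<in>{a \<in> admissible k n s. sum_list (block_sizes k n s a) = m}.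
      ?G s (block_sizes k n s a) a)"
  proof (intro sum.cong refl sum_tuples)
    fix s r a
    assume *: "s \<in> {1..k}" "r \<in> all_compositions m" "a \<in> tuples k s (length r)"
    assume "?G s r a \<noteq> 0"
    then obtain \<sigma> where "composite (dec \<beta> k \<theta> (place k s a)) r \<sigma> x \<noteq> 0"
      by (metis (no_types, lifting) V.scale_zero_right sum.neutral)
    from composite_place_nonzero[OF *(2,1,3) this]
    show "length r = n s + 1 \<and> r = block_sizes k n s a" by simp
  qed
  finally show ?thesis
    by (simp only: l_value_Fn_composite mult.commute[of "(-1) ^ _" "of_int _"])
qed

lemma sum_list_block_sizes_admissible:
  assumes "int t = - int k + 2 + (\<Sum>s=1..k. int (n s))" "s \<in> {1..k}" "a \<in> admissible k n s"
  shows "sum_list (block_sizes k n s a) = t"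
  using sum_list_block_sizes[of s k a n] assms by (simp add: admissible_eq)

lemma multilinear_l_value_Fn:
  "multilinear sU sV m (\<lambda>xs. l_value sV (gamma_W (inputs xs) y) \<beta> k n \<theta> (Fn m))"
  unfolding multilinear_def l_value_Fn_composite
\<comment> \<open>Peels off signs and sums until a single composite remains.\<close>
proof (intro allI impI linear_scale linear_sum vector_space_U vector_space_V)
  fix xs :: "'u list" and i r \<sigma> v
  assume xs: "length xs = m" "i < m" and r: "r \<in> all_compositions m" and \<sigma>: "\<sigma> \<in> unshuffles_less r"
  note R = all_compositionsD[OF r]
  have "\<sigma> permutes {1..m}"
    using \<sigma> R(3) by (simp add: unshuffles_less_def unshuffles_def)
  from multilinear_composite[OF homogeneous_dec R(1-3) this] xs
  show "Vector_Spaces.linear sU sV (\<lambda>x. composite (dec \<beta> k \<theta> v) r \<sigma> (inputs (xs[i := x])))"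
    by (simp add: multilinear_def)
qed

text \<open>The block sizes of every admissible tuple add up to \<open>t\<close>, so for
  \<open>m \<noteq> t\<close> the sum giving the value on \<open>Fn m\<close> is empty.\<close>

lemma homogeneous_l_op:
  assumes "int t = - int k + 2 + (\<Sum>s=1..k. int (n s))"
  shows "homogeneous sU sV t (l_op sU sV \<beta> k n \<theta>)"
proof -
  have "l_value sV (gamma_W x y) \<beta> k n \<theta> (Fn m) = 0" if "m \<noteq> t" for m x y
  proof -
    have "{a \<in> admissible k n s. sum_list (block_sizes k n s a) = m} = {}" if "s \<in> {1..k}" for s
      using sum_list_block_sizes_admissible[OF assms that] \<open>m \<noteq> t\<close> by auto
    then show ?thesis
      by (simp add: l_value_Fn_admissible del: Collect_empty_eq)
  qed
  then show ?thesis
    by (auto simp: homogeneous_def l_op_def U.l_value_Mu_Nu[OF three_le]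
        V.l_value_Mu_Nu[OF three_le] multilinear_zero vector_space_U vector_space_V
        multilinear_l_value_Fn vanishes_def)
qed

end

section \<open>The map \<open>beta\<close> and the generalized comp operation\<close>

lemma multilinear_bilinear:
  assumes "vector_space sA"
    and "\<And>y. Vector_Spaces.linear sA sA (\<lambda>x. f x y)"
    and "\<And>x. Vector_Spaces.linear sA sA (\<lambda>y. f x y)"
  shows "multilinear sA sA 2 (\<lambda>xs. f (xs ! 0) (xs ! 1))"
  using assms by (auto simp: multilinear_def less_2_cases_iff)

lemma homogeneous_beta:
  assumes "lie_algebra sU muU" "lie_algebra sV muV" "lie_morphism sU muU sV muV g"
  shows "homogeneous sU sV 1 (beta muU muV g)"
proof -
  interpret U: lie_algebra sU muU by fact
  interpret V: lie_algebra sV muV by fact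
  note vs = U.vector_space_axioms V.vector_space_axioms
  have "multilinear sU sU m (at_mu (beta muU muV g) m)" for m
    using multilinear_bilinear[OF vs(1) U.linear_left U.linear_right] multilinear_zero[OF vs(1,1)]
    by (cases "m = 2") (simp_all add: beta_def)
  moreover have "multilinear sV sV m (at_nu (beta muU muV g) m)" for m
    using multilinear_bilinear[OF vs(2) V.linear_left V.linear_right] multilinear_zero[OF vs(2,2)]
    by (cases "m = 2") (simp_all add: beta_def)
  moreover have "multilinear sU sV m (at_f (beta muU muV g) m)" for m
    using assms(3) multilinear_zero[OF vs]
    by (cases "m = 1") (auto simp: beta_def lie_morphism_def multilinear_def)
  ultimately show ?thesis
    by (auto simp: homogeneous_def beta_def vanishes_def)
qed

text \<open>\<open>composite\<close> reads inputs leg by leg through \<open>\<sigma>\<close>, while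
  \<open>gen_comp\<close> cuts the permuted list into blocks. The blocks agree, and so do the maps
  applied to them: \<open>\<theta> j\<close> in its own degree, or \<open>g\<close> on a single
  entry.\<close>

lemma composite_place_gen_comp:
  assumes s: "s \<in> {1..k}" and a: "a \<in> admissible k n s"
    and xs: "length xs = sum_list (block_sizes k n s a)"
  shows "composite (dec (beta muU muV g) k \<theta> (place k s a)) (block_sizes k n s a) \<sigma> (inputs xs)
    = gen_comp g k n \<theta> s a (perm_args \<sigma> xs)"
proof -
  let ?r = "block_sizes k n s a" and ?K = "{1..k} - {s}"
  have t: "a \<in> tuples k s (n s + 1)"
    using a by (simp add: admissible_eq)
  have blk: "map (\<lambda>p. inputs xs (\<sigma> p)) [Suc (psum ?r i)..<Suc (psum ?r i + ?r ! i)]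
      = take (?r ! i) (drop (psum ?r i) (perm_args \<sigma> xs))" if "i < n s + 1" for i
  proof -
    have "psum ?r i + ?r ! i \<le> length xs"
      using psum_Suc[of i ?r] psum_le[of ?r "Suc i"] that xs by simp
    then show ?thesis
      by (intro nth_equalityI) (auto simp: perm_args_def inputs_def simp del: upt_Suc)
  qed
  have child: "at_f (dec (beta muU muV g) k \<theta> (place k s a) [i]) (?r ! i) bs
      = (if Suc i \<in> a ` ?K then let j = inv_into ?K a (Suc i) in at_f (\<theta> j) (n j) bs else g (hd bs))"
    if i: "i < n s + 1" and bs: "length bs = ?r ! i" for i bs
  proof (cases "Suc i \<in> a ` ?K")
    case True
    then show ?thesis
      unfolding nth_block_sizes[where n = n, OF t i] dec_place_child[OF t] by (simp only: if_True Let_def)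
  next
    case False
    \<comment> \<open>At a free point the default size 1 applies, so \<open>bs\<close> has a single
      entry and \<open>beta\<close> at \<open>Fn 1\<close> is \<open>g\<close> of its head.\<close>
    then have 1: "?r ! i = 1"
      unfolding nth_block_sizes[where n = n, OF t i] dec_place_child[OF t] by (simp only: if_False)
    with False bs show ?thesis
      unfolding 1 dec_place_child[OF t] by (cases bs) (simp_all only: if_False, simp_all add: beta_def)
  qed
  have "length (take (?r ! i) (drop (psum ?r i) (perm_args \<sigma> xs))) = ?r ! i" if "i < n s + 1" for i
    unfolding blk[OF that, symmetric] by (simp del: upt_Suc)
  note child_blk = child[OF _ this]
  show ?thesis
    unfolding composite_def gen_comp_def dec_place_root[OF s t] length_block_sizes
    by (rule arg_cong[of _ _ "at_nu (\<theta> s) (n s + 1)"], rule nth_equalityI)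
      (simp_all add: blk child_blk Let_def del: upt_Suc length_take)
qed

theorem theorem8p4:
  fixes sU :: "'k::field_char_0 \<Rightarrow> 'u::ab_group_add \<Rightarrow> 'u"
    and sV :: "'k \<Rightarrow> 'v::ab_group_add \<Rightarrow> 'v"
    and muU :: "'u \<Rightarrow> 'u \<Rightarrow> 'u"
    and muV :: "'v \<Rightarrow> 'v \<Rightarrow> 'v"
    and g :: "'u \<Rightarrow> 'v"
    and k t :: nat
    and n :: "nat \<Rightarrow> nat"
    and \<theta> :: "nat \<Rightarrow> ('u, 'v) emap"
    and L :: "('u, 'v) emap"
  assumes "lie_algebra sU muU"
    and "lie_algebra sV muV"
    and "lie_morphism sU muU sV muV g"
    and "3 \<le> k"
    and "\<And>s. s \<in> {1..k} \<Longrightarrow> 1 \<le> n s"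
    and "\<And>s. s \<in> {1..k} \<Longrightarrow> cochain sU sV (n s) (\<theta> s)"
    and "int t = - int k + 2 + (\<Sum>s=1..k. int (n s))"
    and "L = l_op sU sV (beta muU muV g) k n \<theta>"
  shows "homogeneous sU sV t L
    \<and> (\<forall>xs. length xs = t + 1 \<longrightarrow> at_mu L (t + 1) xs = 0)
    \<and> (\<forall>ys. length ys = t + 1 \<longrightarrow> at_nu L (t + 1) ys = 0)
    \<and> (\<forall>xs. length xs = t \<longrightarrow> at_f L t xs =
        sV ((-1) ^ nu_exponent k n)
          (\<Sum>s=1..k. \<Sum>a\<in>admissible k n s. \<Sum>\<sigma>\<in>unshuffles_less (block_sizes k n s a).
             sV (of_int (sign \<sigma>) * (-1) ^ block_exponent (block_sizes k n s a))
               (gen_comp g k n \<theta> s a (perm_args \<sigma> xs))))"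
proof -
  interpret U: lie_algebra sU muU by fact
  interpret V: lie_algebra sV muV by fact
  interpret cochain_family sU sV "beta muU muV g" k n \<theta>
    using assms homogeneous_beta[OF assms(1-3)]
    by unfold_locales (simp_all add: cochain_def)
  have "at_f L t xs = sV ((-1) ^ nu_exponent k n)
      (\<Sum>s=1..k. \<Sum>a\<in>admissible k n s. \<Sum>\<sigma>\<in>unshuffles_less (block_sizes k n s a).
         sV (of_int (sign \<sigma>) * (-1) ^ block_exponent (block_sizes k n s a))
           (gen_comp g k n \<theta> s a (perm_args \<sigma> xs)))" if xs: "length xs = t" for xs
  proof -
    \<comment> \<open>For \<open>m = t\<close> the condition on the total size holds for every
      admissible tuple.\<close>
    have "{a \<in> admissible k n s. sum_list (block_sizes k n s a) = t} = admissible k n s"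
      if "s \<in> {1..k}" for s
      using sum_list_block_sizes_admissible[OF assms(7) that] by auto
    moreover have "composite (dec (beta muU muV g) k \<theta> (place k s a)) (block_sizes k n s a) \<sigma> (inputs xs)
        = gen_comp g k n \<theta> s a (perm_args \<sigma> xs)"
      if "s \<in> {1..k}" "a \<in> admissible k n s" for s a \<sigma>
      using composite_place_gen_comp[OF that] sum_list_block_sizes_admissible[OF assms(7) that] xs
      by simp
    ultimately show ?thesis
      unfolding assms(8) l_op_def emap.simps l_value_Fn_admissible
      by (intro arg_cong[of _ _ "sV _"] sum.cong) simp_all
  qed
  moreover have "homogeneous sU sV t L"
    unfolding assms(8) by (rule homogeneous_l_op[OF assms(7)])
  ultimately show ?thesis
    by (simp add: assms(8) l_op_def U.l_value_Mu_Nu[OF assms(4)] V.l_value_Mu_Nu[OF assms(4)])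
qed

end
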